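(* Let $s\ge 2$ and $k\ge 1$ be integers and let $\tau_0,\dots,\tau_{k-1}\in\{0,\dots,s-1\}^2$ be pairwise distinct, defining an NBB fractal family with Hausdorff dimension $\mathcal{H}=\log(k)/\log(s)$. Let $n=b\,n_b$ be the linear size of the fractal, where $b$ is the linear size of a block and $n_b=s^{r_b}$ is the block-space linear size. Then there exist a $2$-orthotope $\Pi^2\subset\mathbb{Z}^2$ of block coordinates of size $|\Pi^2|=\mathcal{O}(n^{\mathcal{H}})$ and a map $\lambda:\Pi^2\to\mathbb{Z}^2$ which maps $\Pi^2$ one-to-one onto the block-space fractal $\mathcal{F}_{n_b}^{k,s}$, such that for each block coordinate $\omega\in\Pi^2$ the value $\lambda(\omega)$ is computed in $\mathcal{O}(\log_2\log_2(n_b))$ parallel time by $|B|=\Theta\!\left(\frac{\log_2(n_b)}{\log_2\log_2(n_b)}\right)$ threads of the block $\omega$. Asymptotics are as $n_b\to\infty$, with constants allowed to depend on $k$, $s$ and the offsets.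
   Context: NBB (Non-overlapping Bottom-up Boxes) fractals: given integers $s\ge2$ (scale-up factor), $k\ge1$ (number of replicas) and $k$ distinct replica offsets $\tau_0,\dots,\tau_{k-1}\in\{0,\dots,s-1\}^2$, the fractal of linear size $n=s^r$ (scale level $r=\log_s(n)$) is the finite set $\mathcal{F}_n^{k,s}\subset\{0,\dots,n-1\}^2$ defined by $\mathcal{F}_1^{k,s}=\{(0,0)\}$ and $\mathcal{F}_{sn}^{k,s}=\bigcup_{i=0}^{k-1}\left(\mathcal{F}_n^{k,s}+n\,\tau_i\right)$. The bounding boxes of the $k$ replicas do not overlap. A $2$-orthotope is a discrete rectangle $\{0,\dots,p-1\}\times\{0,\dots,q-1\}$. Block-space: threads are grouped into blocks of $b\times b$ threads. The fractal of linear size $n$ is coarsened to the block-space fractal $\mathcal{F}_{n_b}^{k,s}$ of linear size $n_b=n/b=s^{r_b}$ (the same family at scale level $r_b$), each element of which represents a block. The parallel space $\Pi^2$ is an orthotope whose elements $\omega=(\omega_x,\omega_y)$ are block coordinates, and $|\Pi^2|$ is its number of blocks. A thread map sends each point of parallel space to a unique point of data space; here $\lambda$ acts on block coordinates. Computation model: the blocks work in parallel and independently of each other. The threads within one block run synchronously and communicate through memory shared by the block (as in a PRAM), with unit-cost integer arithmetic (addition, multiplication, integer division, modulo) and unit-cost access to a table of size $k$ containing the offsets $\tau_i$. The time of $\lambda(\omega)$ is the number of parallel steps used by the threads of the block $\omega$. *)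

theory Defs
  imports Complex_Main "HOL-Library.Landau_Symbols"
begin

section \<open>NBB fractals\<close>

text \<open>The fractal is indexed by its scale level \<open>r\<close>; its linear size is \<open>n = s ^ r\<close>.
  The offsets \<open>\<tau>\<^sub>0, \<dots>, \<tau>\<^sub>k\<^sub>-\<^sub>1\<close> are the entries of a list of length \<open>k\<close>.\<close>

fun nbb_fractal :: "nat \<Rightarrow> (int \<times> int) list \<Rightarrow> nat \<Rightarrow> (int \<times> int) set" where
  "nbb_fractal s \<tau> 0 = {(0, 0)}"
| "nbb_fractal s \<tau> (Suc r) =
     (\<Union>i<length \<tau>. (\<lambda>(x, y). (x + int s ^ r * fst (\<tau> ! i), y + int s ^ r * snd (\<tau> ! i)))
        ` nbb_fractal s \<tau> r)"

definition nbb_dim :: "nat \<Rightarrow> nat \<Rightarrow> real" where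
  "nbb_dim s k = ln (real k) / ln (real s)"

definition is_orthotope2 :: "(int \<times> int) set \<Rightarrow> bool" where
  "is_orthotope2 A \<longleftrightarrow> (\<exists>p q :: nat. A = {0..<int p} \<times> {0..<int q})"

section \<open>Synchronous threads of a block\<close>

text \<open>A block is a CREW PRAM. All threads run the same program on private registers and a shared
  memory; in each parallel step every thread that has not halted executes one instruction. Register
  operands are given by their index.
  A thread halts when its program counter leaves the program.\<close>

datatype instr =
    Const nat int
  | Add nat nat nat
  | Mul nat nat nat
  | Div nat nat nat
  | Mod nat nat nat
  | OffsetX nat nat
  | OffsetY nat nat
  | Load nat nat
  | Store nat nat
  | JumpLess nat nat nat

type_synonym thread = "nat \<times> (nat \<Rightarrow> int)"  \<comment> \<open>program counter and registers\<close>
type_synonym memory = "int \<Rightarrow> int"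

text \<open>The table has exactly \<open>length \<tau>\<close> entries: a lookup outside its range yields no information.\<close>

definition lookup :: "(int \<times> int) list \<Rightarrow> int \<Rightarrow> int \<times> int" where
  "lookup \<tau> i = (if 0 \<le> i \<and> i < int (length \<tau>) then \<tau> ! nat i else (0, 0))"

fun exec :: "(int \<times> int) list \<Rightarrow> memory \<Rightarrow> instr \<Rightarrow> thread \<Rightarrow> thread" where
  "exec \<tau> m (Const d c) (pc, R) = (Suc pc, R(d := c))"
| "exec \<tau> m (Add d a b) (pc, R) = (Suc pc, R(d := R a + R b))"
| "exec \<tau> m (Mul d a b) (pc, R) = (Suc pc, R(d := R a * R b))"
| "exec \<tau> m (Div d a b) (pc, R) = (Suc pc, R(d := R a div R b))"
| "exec \<tau> m (Mod d a b) (pc, R) = (Suc pc, R(d := R a mod R b))"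
| "exec \<tau> m (OffsetX d a) (pc, R) = (Suc pc, R(d := fst (lookup \<tau> (R a))))"
| "exec \<tau> m (OffsetY d a) (pc, R) = (Suc pc, R(d := snd (lookup \<tau> (R a))))"
| "exec \<tau> m (Load d a) (pc, R) = (Suc pc, R(d := m (R a)))"
| "exec \<tau> m (Store a v) (pc, R) = (Suc pc, R)"
| "exec \<tau> m (JumpLess a b l) (pc, R) = (if R a < R b then l else Suc pc, R)"

definition halted :: "instr list \<Rightarrow> thread \<Rightarrow> bool" where
  "halted P th \<longleftrightarrow> length P \<le> fst th"

definition thread_step :: "instr list \<Rightarrow> (int \<times> int) list \<Rightarrow> memory \<Rightarrow> thread \<Rightarrow> thread" where
  "thread_step P \<tau> m th = (if halted P th then th else exec \<tau> m (P ! fst th) th)"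

definition thread_write :: "instr list \<Rightarrow> thread \<Rightarrow> (int \<times> int) list" where
  "thread_write P th =
     (if halted P th then []
      else case P ! fst th of Store a v \<Rightarrow> [(snd th a, snd th v)] | _ \<Rightarrow> [])"

definition block_writes :: "instr list \<Rightarrow> thread list \<Rightarrow> (int \<times> int) list" where
  "block_writes P ths = concat (map (thread_write P) ths)"

text \<open>All reads of a step see the memory before the step. There is no successor state if two threads
  would write to the same address.\<close>

inductive block_step ::
  "instr list \<Rightarrow> (int \<times> int) list \<Rightarrow> thread list \<times> memory \<Rightarrow> thread list \<times> memory \<Rightarrow> bool"
  for P :: "instr list" and \<tau> :: "(int \<times> int) list" where
  "distinct (map fst (block_writes P ths)) \<Longrightarrow>
   block_step P \<tau> (ths, m)
     (map (thread_step P \<tau> m) ths,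
      \<lambda>a. case map_of (block_writes P ths) a of None \<Rightarrow> m a | Some v \<Rightarrow> v)"

text \<open>Thread \<open>t\<close> of \<open>p\<close> threads starts with its index, the number of threads, the linear size of
  the block-space fractal and the coordinates of its block in registers 0 to 4.\<close>

definition init_thread :: "nat \<Rightarrow> nat \<Rightarrow> int \<times> int \<Rightarrow> nat \<Rightarrow> thread" where
  "init_thread p nb \<omega> t =
     (0, (\<lambda>_. 0)(0 := int t, 1 := int p, 2 := int nb, 3 := fst \<omega>, 4 := snd \<omega>))"

definition init_block :: "nat \<Rightarrow> nat \<Rightarrow> int \<times> int \<Rightarrow> thread list \<times> memory" where
  "init_block p nb \<omega> = (map (init_thread p nb \<omega>) [0..<p], \<lambda>_. 0)"

text \<open>The result is left in the shared memory cells 0 and 1.\<close>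

definition block_computes_within ::
  "instr list \<Rightarrow> (int \<times> int) list \<Rightarrow> nat \<Rightarrow> nat \<Rightarrow> int \<times> int \<Rightarrow> int \<times> int \<Rightarrow> nat \<Rightarrow> bool" where
  "block_computes_within P \<tau> p nb \<omega> z T \<longleftrightarrow>
     (\<exists>t\<le>T. \<exists>ths m. (block_step P \<tau> ^^ t) (init_block p nb \<omega>) (ths, m) \<and>
        (\<forall>th\<in>set ths. halted P th) \<and> (m 0, m 1) = z)"

end

theory Submission
  imports Defs
begin

text \<open>The parallel space is a strip of \<open>k ^ r\<close> blocks: the base-\<open>k\<close> digits of the block number
  select the replica at each scale, and the block is sent to the sum of the offsets selected by
  digit \<open>j\<close> scaled by \<open>s ^ j\<close>. A block uses \<open>p = 2 ^ q\<close> threads, where \<open>q \<ge> 1\<close> is least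
  with \<open>r \<le> q * 2 ^ q\<close>. Thread \<open>t\<close> removes the lowest \<open>t\<close> digits by repeated squaring
  of \<open>k\<close>, sums the contributions of the \<open>q\<close> digits \<open>t, t + p, t + 2 * p, \<dots>\<close>, and a doubling
  reduction adds up the partial sums; each of the three loops takes \<open>q\<close> rounds. The digits from \<open>r\<close> on
  are \<open>0\<close>, but the offset they select need not vanish; their contribution is a multiple of \<open>s ^ r\<close>, so
  reducing modulo the linear size removes it and the threads never need \<open>r\<close>. No jump depends on
  the thread, so all threads share one program counter.\<close>

section \<open>Lockstep execution\<close>

text \<open>The registers are a total function of the thread index, but only threads below
  \<open>p\<close> belong to the state; so the invariants constrain \<open>R t\<close> only for
  \<open>t < p\<close>.\<close>

definition lockstep :: "nat \<Rightarrow> nat \<Rightarrow> (nat \<Rightarrow> nat \<Rightarrow> int) \<Rightarrow> memory \<Rightarrow> thread list \<times> memory" where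
  "lockstep p pc R m = (map (\<lambda>t. (pc, R t)) [0..<p], m)"

text \<open>The program counter 0 is a dummy: no instruction lets it influence the
  registers.\<close>

definition reg_exec :: "(int \<times> int) list \<Rightarrow> memory \<Rightarrow> instr \<Rightarrow> (nat \<Rightarrow> int) \<Rightarrow> nat \<Rightarrow> int" where
  "reg_exec \<tau> m i R = snd (exec \<tau> m i (0, R))"

fun plain :: "instr \<Rightarrow> bool" where
  "plain (Store a v) = False"
| "plain (JumpLess a b l) = False"
| "plain _ = True"

lemma exec_plain: "plain i \<Longrightarrow> exec \<tau> m i (pc, R) = (Suc pc, reg_exec \<tau> m i R)"
  by (cases i) (auto simp: reg_exec_def)

text \<open>Jumps are covered too. After a jump the program counters may differ, hence the successor
  is a mapped list and not yet a \<open>lockstep\<close> state.\<close>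

lemma block_step_lockstep_silent:
  assumes "pc < length P" and "\<And>a v. P ! pc \<noteq> Store a v"
  shows "block_step P \<tau> (lockstep p pc R m) (map (\<lambda>t. exec \<tau> m (P ! pc) (pc, R t)) [0..<p], m)"
proof -
  have w: "thread_write P (pc, R t) = []" for t
    using assms by (auto simp: thread_write_def split: instr.split)
  have "block_writes P (map (\<lambda>t. (pc, R t)) [0..<p]) = []"
    by (auto simp: block_writes_def w)
  then show ?thesis
    using block_step.intros[of P "map (\<lambda>t. (pc, R t)) [0..<p]" \<tau> m] assms(1)
    by (simp add: lockstep_def thread_step_def halted_def o_def)
qed

lemma block_step_lockstep_plain:
  assumes "pc < length P" and "plain (P ! pc)"
  shows "block_step P \<tau> (lockstep p pc R m)
           (lockstep p (Suc pc) (\<lambda>t. reg_exec \<tau> m (P ! pc) (R t)) m)"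
proof -
  have "P ! pc \<noteq> Store a v" for a v
    using assms(2) by auto
  from block_step_lockstep_silent[OF assms(1) this, of \<tau> p R m] show ?thesis
    by (simp add: exec_plain[OF assms(2)] lockstep_def)
qed

lemma block_step_lockstep_jump:
  assumes "pc < length P" and "P ! pc = JumpLess a b l"
    and "\<And>t. t < p \<Longrightarrow> R t a < R t b \<longleftrightarrow> c"
  shows "block_step P \<tau> (lockstep p pc R m) (lockstep p (if c then l else Suc pc) R m)"
proof -
  have "map (\<lambda>t. exec \<tau> m (P ! pc) (pc, R t)) [0..<p]
      = map (\<lambda>t. (if c then l else Suc pc, R t)) [0..<p]"
    using assms(2,3) by (intro map_cong) auto
  moreover have "block_step P \<tau> (lockstep p pc R m)
      (map (\<lambda>t. exec \<tau> m (P ! pc) (pc, R t)) [0..<p], m)"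
    using assms(2) by (intro block_step_lockstep_silent[OF assms(1)]) auto
  ultimately show ?thesis
    unfolding lockstep_def by metis
qed

text \<open>Injectivity of \<open>f\<close> is the exclusive-write condition: a clash of addresses
  would leave the block without a successor.\<close>

lemma block_step_lockstep_store:
  assumes "pc < length P" and "P ! pc = Store a v"
    and addr: "\<And>t. t < p \<Longrightarrow> R t a = f t" and inj: "inj_on f {..<p}"
  shows "\<exists>m'. block_step P \<tau> (lockstep p pc R m) (lockstep p (Suc pc) R m') \<and>
           (\<forall>t<p. m' (f t) = R t v) \<and> (\<forall>x. x \<notin> f ` {..<p} \<longrightarrow> m' x = m x)"
proof -
  define W where "W = map (\<lambda>t. (f t, R t v)) [0..<p]"
  have writes: "block_writes P (map (\<lambda>t. (pc, R t)) [0..<p]) = W"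
  proof -
    have "map (thread_write P) (map (\<lambda>t. (pc, R t)) [0..<p]) = map (\<lambda>t. [(f t, R t v)]) [0..<p]"
      using assms(1,2) addr by (auto simp: thread_write_def halted_def)
    then show ?thesis
      unfolding block_writes_def W_def by (simp only: concat_map_singleton)
  qed
  have dist: "distinct (map fst W)"
    using inj by (auto simp: W_def o_def distinct_map lessThan_atLeast0)
  define m' where "m' = (\<lambda>x. case map_of W x of None \<Rightarrow> m x | Some y \<Rightarrow> y)"
  have "block_step P \<tau> (lockstep p pc R m) (lockstep p (Suc pc) R m')"
    using block_step.intros[of P "map (\<lambda>t. (pc, R t)) [0..<p]" \<tau> m] assms(1,2) dist
    by (simp add: lockstep_def writes m'_def thread_step_def halted_def o_def)
  moreover have "m' (f t) = R t v" if "t < p" for t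
  proof -
    have "(f t, R t v) \<in> set W"
      using that by (auto simp: W_def)
    with dist show ?thesis
      by (simp add: m'_def)
  qed
  moreover have "m' x = m x" if "x \<notin> f ` {..<p}" for x
  proof -
    have "map_of W x = None"
      using that by (auto simp: W_def map_of_eq_None_iff lessThan_atLeast0)
    then show ?thesis
      by (simp add: m'_def)
  qed
  ultimately show ?thesis
    by blast
qed

text \<open>Straight-line code without stores keeps \<open>m\<close> fixed, so the threads do not
  interact and each one folds over the instructions on its own.\<close>

lemma lockstep_plain:
  assumes "take (length is) (drop pc P) = is" and "list_all plain is"
  shows "(block_step P \<tau> ^^ length is) (lockstep p pc R m)
           (lockstep p (pc + length is) (\<lambda>t. fold (reg_exec \<tau> m) is (R t)) m)"
  using assms
proof (induction "is" arbitrary: pc R)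
  case Nil
  then show ?case by simp
next
  case (Cons i "is")
  have pc: "pc < length P"
    using Cons.prems(1) by (cases "pc < length P") auto
  then have "drop pc P = P ! pc # drop (Suc pc) P"
    by (simp add: Cons_nth_drop_Suc)
  with Cons.prems(1) have i: "P ! pc = i" and rest: "take (length is) (drop (Suc pc) P) = is"
    by auto
  have "block_step P \<tau> (lockstep p pc R m) (lockstep p (Suc pc) (\<lambda>t. reg_exec \<tau> m i (R t)) m)"
    using block_step_lockstep_plain[OF pc] i Cons.prems(2) by simp
  moreover have "(block_step P \<tau> ^^ length is) (lockstep p (Suc pc) (\<lambda>t. reg_exec \<tau> m i (R t)) m)
      (lockstep p (Suc pc + length is) (\<lambda>t. fold (reg_exec \<tau> m) is (reg_exec \<tau> m i (R t))) m)"
    using Cons.IH[OF rest] Cons.prems(2) by simp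
  ultimately show ?case
    using relpowp_Suc_I2 by fastforce
qed

lemma lockstep_segment:
  assumes "take n (drop pc P) = is" and "length is = n" and "list_all plain is" and "pc + n = pc'"
  shows "(block_step P \<tau> ^^ n) (lockstep p pc R m)
           (lockstep p pc' (\<lambda>t. fold (reg_exec \<tau> m) is (R t)) m)"
  using lockstep_plain[of "is" pc P \<tau> p R m] assms by simp

text \<open>The test follows the body: a round costs \<open>n + 1\<close> steps and the body runs at
  least once, whence \<open>0 < q\<close>. The invariant must decide the test uniformly in all
  threads, so that they stay together.\<close>

lemma lockstep_loop:
  assumes "pc + n < length P" and "P ! (pc + n) = JumpLess a b pc"
    and body: "\<And>i R m. i < q \<Longrightarrow> I i R m \<Longrightarrow> \<exists>R' m'.
      (block_step P \<tau> ^^ n) (lockstep p pc R m) (lockstep p (pc + n) R' m') \<and> I (Suc i) R' m'"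
    and cond: "\<And>i R m t. I i R m \<Longrightarrow> t < p \<Longrightarrow> R t a < R t b \<longleftrightarrow> i < q"
    and "I 0 R m" and "0 < q"
  shows "\<exists>R' m'. (block_step P \<tau> ^^ (q * Suc n)) (lockstep p pc R m)
           (lockstep p (pc + Suc n) R' m') \<and> I q R' m'"
proof -
  \<comment> \<open>Induction on the completed rounds: the program counter is back at the loop head
    while rounds remain and past the jump after the last one.\<close>
  have "i \<le> q \<Longrightarrow> \<exists>R' m'. (block_step P \<tau> ^^ (i * Suc n)) (lockstep p pc R m)
      (lockstep p (if i < q then pc else pc + Suc n) R' m') \<and> I i R' m'" for i
  proof (induction i)
    case 0
    then show ?case using assms(5,6) by auto
  next
    case (Suc i)
    then obtain R1 m1 where 1: "(block_step P \<tau> ^^ (i * Suc n)) (lockstep p pc R m) (lockstep p pc R1 m1)"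
        "I i R1 m1"
      by auto
    obtain R2 m2 where 2: "(block_step P \<tau> ^^ n) (lockstep p pc R1 m1) (lockstep p (pc + n) R2 m2)"
        "I (Suc i) R2 m2"
      using body[OF _ 1(2)] Suc.prems by auto
    have "block_step P \<tau> (lockstep p (pc + n) R2 m2)
        (lockstep p (if Suc i < q then pc else Suc (pc + n)) R2 m2)"
      by (rule block_step_lockstep_jump[OF assms(1,2) cond[OF 2(2)]])
    with 2(1) have "(block_step P \<tau> ^^ Suc n) (lockstep p pc R1 m1)
        (lockstep p (if Suc i < q then pc else Suc (pc + n)) R2 m2)"
      by (rule relpowp_Suc_I)
    with 1(1) have "(block_step P \<tau> ^^ (i * Suc n + Suc n)) (lockstep p pc R m)
        (lockstep p (if Suc i < q then pc else Suc (pc + n)) R2 m2)"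
      by (rule relpowp_trans)
    moreover have "i * Suc n + Suc n = Suc i * Suc n" "Suc (pc + n) = pc + Suc n"
      by simp_all
    ultimately show ?case
      using 2(2) by metis
  qed
  from this[of q] show ?thesis
    by simp
qed

section \<open>Base-\<open>k\<close> digits and the fractal\<close>

text \<open>This is the offset selected by the digit, not the digit itself. For a nonempty table the
  remainder is always a valid index.\<close>

definition digit :: "(int \<times> int) list \<Rightarrow> int \<Rightarrow> nat \<Rightarrow> int \<times> int" where
  "digit \<tau> w j = lookup \<tau> (w div int (length \<tau>) ^ j mod int (length \<tau>))"

text \<open>The projection \<open>f\<close> stands for \<open>fst\<close> or \<open>snd\<close>, so
  that both coordinates share one set of lemmas.\<close>

definition coord :: "nat \<Rightarrow> (int \<times> int) list \<Rightarrow> (int \<times> int \<Rightarrow> int) \<Rightarrow> int \<Rightarrow> nat \<Rightarrow> int" where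
  "coord s \<tau> f w r = (\<Sum>j<r. int s ^ j * f (digit \<tau> w j))"

definition nbb_map :: "nat \<Rightarrow> (int \<times> int) list \<Rightarrow> nat \<Rightarrow> int \<times> int \<Rightarrow> int \<times> int" where
  "nbb_map s \<tau> r \<omega> = (coord s \<tau> fst (fst \<omega>) r, coord s \<tau> snd (fst \<omega>) r)"

text \<open>The default \<open>(0, 0)\<close> of a failed lookup also lies in the square because
  \<open>s \<ge> 1\<close>; so \<open>i\<close> is arbitrary.\<close>

lemma lookup_bounds:
  assumes "s \<ge> 1" and "set \<tau> \<subseteq> {0..<int s} \<times> {0..<int s}" and "f = fst \<or> f = snd"
  shows "0 \<le> f (lookup \<tau> i)" and "f (lookup \<tau> i) < int s"
proof -
  have "lookup \<tau> i \<in> {0..<int s} \<times> {0..<int s}"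
    using assms(1) subsetD[OF assms(2), OF nth_mem[of "nat i" \<tau>]] by (auto simp: lookup_def nat_less_iff)
  then show "0 \<le> f (lookup \<tau> i)" "f (lookup \<tau> i) < int s"
    using assms(3) by auto
qed

lemma digit_sum_bounds:
  fixes a :: "nat \<Rightarrow> int"
  assumes "\<And>j. 0 \<le> a j \<and> a j < int s"
  shows "0 \<le> (\<Sum>j<r. int s ^ j * a j) \<and> (\<Sum>j<r. int s ^ j * a j) < int s ^ r"
proof (induction r)
  case 0
  then show ?case by simp
next
  case (Suc r)
  have "int s ^ r * a r \<le> int s ^ r * (int s - 1)"
    using assms[of r] by (intro mult_left_mono) auto
  then show ?case
    using Suc assms[of r] by (auto simp: algebra_simps)
qed

text \<open>The terms from \<open>r\<close> on are multiples of \<open>s ^ r\<close>, and the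
  remaining sum is already below \<open>s ^ r\<close>.\<close>

lemma digit_sum_mod:
  fixes a :: "nat \<Rightarrow> int"
  assumes "\<And>j. 0 \<le> a j \<and> a j < int s" and "r \<le> N"
  shows "(\<Sum>j<N. int s ^ j * a j) mod int s ^ r = (\<Sum>j<r. int s ^ j * a j)"
proof -
  have "(\<Sum>j<N. int s ^ j * a j) = (\<Sum>j<r. int s ^ j * a j) + (\<Sum>j=r..<N. int s ^ j * a j)"
    using assms(2) by (metis atLeast0LessThan le0 sum.atLeastLessThan_concat)
  moreover have "int s ^ r dvd (\<Sum>j=r..<N. int s ^ j * a j)"
    by (intro dvd_sum dvd_mult2) (auto simp: le_imp_power_dvd)
  ultimately show ?thesis
    using digit_sum_bounds[of a s r] assms(1) by (auto elim: dvdE)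
qed

lemma coord_bounds:
  assumes "s \<ge> 1" and "set \<tau> \<subseteq> {0..<int s} \<times> {0..<int s}" and "f = fst \<or> f = snd"
  shows "0 \<le> coord s \<tau> f w r" and "coord s \<tau> f w r < int s ^ r"
  using digit_sum_bounds[of "\<lambda>j. f (digit \<tau> w j)"]
    lookup_bounds[OF assms] by (auto simp: coord_def digit_def)

text \<open>A new leading digit \<open>i\<close> leaves the lower digits alone and adds the shift of
  replica \<open>i\<close>; this mirrors the recursion of \<open>nbb_fractal\<close>.\<close>

lemma coord_Suc:
  assumes "\<tau> \<noteq> []" and "0 \<le> v" and "v < int (length \<tau>) ^ r" and "i < length \<tau>"
  shows "coord s \<tau> f (int i * int (length \<tau>) ^ r + v) (Suc r) =
    coord s \<tau> f v r + int s ^ r * f (\<tau> ! i)"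
proof -
  let ?k = "int (length \<tau>)"
  have k: "?k > 0" using assms(1) by simp
  have low: "digit \<tau> (int i * ?k ^ r + v) j = digit \<tau> v j" if "j < r" for j
  proof -
    \<comment> \<open>One more factor \<open>?k\<close> than \<open>?k ^ j\<close> is split off, so
      the leading digit shifts the quotient by a multiple of \<open>?k\<close>, which vanishes
      modulo \<open>?k\<close>.\<close>
    have "?k ^ r = ?k ^ j * (?k * ?k ^ (r - Suc j))"
      using that by (metis Suc_diff_Suc power_Suc power_add le_add_diff_inverse less_imp_le_nat)
    then have "int i * ?k ^ r + v = v + ?k ^ j * (?k * (?k ^ (r - Suc j) * int i))"
      by (simp add: algebra_simps)
    moreover have "(v + ?k ^ j * c) div ?k ^ j = c + v div ?k ^ j" for c
      using k by simp
    ultimately have "(int i * ?k ^ r + v) div ?k ^ j = ?k * (?k ^ (r - Suc j) * int i) + v div ?k ^ j"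
      by metis
    then show ?thesis by (simp add: digit_def)
  qed
  have "(int i * ?k ^ r + v) div ?k ^ r = int i"
    using assms(2,3) k by simp
  then have top: "digit \<tau> (int i * ?k ^ r + v) r = \<tau> ! i"
    using assms(4) by (simp add: digit_def lookup_def)
  show ?thesis
    by (simp add: coord_def low top)
qed

text \<open>Induction on the level, splitting off the leading digit. Injectivity expresses that the
  boxes do not overlap: the box containing a point determines the offset, hence the replica, as the
  offsets are distinct.\<close>

lemma bij_betw_nbb_map:
  assumes "s \<ge> 1" and "\<tau> \<noteq> []" and "distinct \<tau>" and "set \<tau> \<subseteq> {0..<int s} \<times> {0..<int s}"
  shows "bij_betw (nbb_map s \<tau> r) ({0..<int (length \<tau> ^ r)} \<times> {0..<int 1}) (nbb_fractal s \<tau> r)"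
proof -
  let ?k = "int (length \<tau>)"
  define g where "g r w = (coord s \<tau> fst w r, coord s \<tau> snd w r)" for r w
  have k: "?k > 0" using assms(2) by simp
  have split: "\<exists>i v. i < length \<tau> \<and> 0 \<le> v \<and> v < ?k ^ r \<and> w = int i * ?k ^ r + v"
    if "w \<in> {0..<?k ^ Suc r}" for w r
  proof (intro exI conjI)
    have "w div ?k ^ r * ?k ^ r \<le> w"
      using k pos_mod_sign[of "?k ^ r" w] div_mult_mod_eq[of w "?k ^ r"] zero_less_power[OF k, of r]
      by linarith
    then have "w div ?k ^ r * ?k ^ r < ?k * ?k ^ r"
      using that by simp
    then have "w div ?k ^ r < ?k" "0 \<le> w div ?k ^ r"
      using that k by (auto simp: pos_imp_zdiv_nonneg_iff)
    then show "nat (w div ?k ^ r) < length \<tau>" "w = int (nat (w div ?k ^ r)) * ?k ^ r + w mod ?k ^ r"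
      by (auto simp: div_mult_mod_eq)
  qed (use k in auto)
  have compose: "int i * ?k ^ r + v \<in> {0..<?k ^ Suc r}" if "i < length \<tau>" "0 \<le> v" "v < ?k ^ r" for i v r
  proof -
    have "(int i + 1) * ?k ^ r \<le> ?k * ?k ^ r"
      using that by (intro mult_right_mono) auto
    with that show ?thesis by (auto simp: algebra_simps)
  qed
  have inj: "inj_on (g r) {0..<?k ^ r}" for r
  proof (induction r)
    case 0
    then show ?case by (auto simp: inj_on_def)
  next
    case (Suc r)
    show ?case
    proof (rule inj_onI)
      fix w w' assume "w \<in> {0..<?k ^ Suc r}" "w' \<in> {0..<?k ^ Suc r}" and eq: "g (Suc r) w = g (Suc r) w'"
      obtain i v i' v' where i: "i < length \<tau>" "0 \<le> v" "v < ?k ^ r" "w = int i * ?k ^ r + v"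
        and i': "i' < length \<tau>" "0 \<le> v'" "v' < ?k ^ r" "w' = int i' * ?k ^ r + v'"
        using split \<open>w \<in> _\<close> \<open>w' \<in> _\<close> by metis
      have *: "f (\<tau> ! i) = f (\<tau> ! i') \<and> coord s \<tau> f v r = coord s \<tau> f v' r"
        if f: "f = fst \<or> f = snd" for f
      proof -
        have e: "coord s \<tau> f v r + int s ^ r * f (\<tau> ! i) = coord s \<tau> f v' r + int s ^ r * f (\<tau> ! i')"
          using eq f by (auto simp: g_def i i' coord_Suc[OF assms(2)])
        have b: "0 \<le> coord s \<tau> f x r" "coord s \<tau> f x r < int s ^ r" for x
          using coord_bounds[OF assms(1,4) f] by auto
        \<comment> \<open>The lower part is less than \<open>s ^ r\<close>, so division by
          \<open>s ^ r\<close> recovers the offset.\<close>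
        have "(coord s \<tau> f x r + int s ^ r * y) div int s ^ r = y" for x y
          using b[of x] assms(1) by simp
        from this[of v] this[of v'] e have "f (\<tau> ! i) = f (\<tau> ! i')"
          by metis
        with e show ?thesis by simp
      qed
      from *[of fst] *[of snd] have "\<tau> ! i = \<tau> ! i'" "g r v = g r v'"
        by (auto simp: g_def prod_eq_iff)
      then have "i = i'" "v = v'"
        using assms(3) i i' inj_onD[OF Suc] by (auto simp: nth_eq_iff_index_eq)
      then show "w = w'" by (simp add: i i')
    qed
  qed
  have img: "g r ` {0..<?k ^ r} = nbb_fractal s \<tau> r" for r
  proof (induction r)
    case 0
    then show ?case by (simp add: g_def coord_def image_constant_conv)
  next
    case (Suc r)
    have g_Suc: "g (Suc r) (int i * ?k ^ r + v) =
        (\<lambda>(x, y). (x + int s ^ r * fst (\<tau> ! i), y + int s ^ r * snd (\<tau> ! i))) (g r v)"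
      if "i < length \<tau>" "0 \<le> v" "v < ?k ^ r" for i v
      using that by (simp add: g_def coord_Suc[OF assms(2)])
    show ?case
    proof (intro equalityI subsetI)
      fix z assume "z \<in> g (Suc r) ` {0..<?k ^ Suc r}"
      then obtain w where "w \<in> {0..<?k ^ Suc r}" "z = g (Suc r) w" by blast
      with split obtain i v where "i < length \<tau>" "0 \<le> v" "v < ?k ^ r" "z = g (Suc r) (int i * ?k ^ r + v)"
        by metis
      then show "z \<in> nbb_fractal s \<tau> (Suc r)"
        unfolding nbb_fractal.simps Suc[symmetric]
        by (intro UN_I[of i] image_eqI[of _ _ "g r v"]) (auto simp: g_Suc)
    next
      fix z assume "z \<in> nbb_fractal s \<tau> (Suc r)"
      then obtain i v where "i < length \<tau>" "0 \<le> v" "v < ?k ^ r"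
        "z = (\<lambda>(x, y). (x + int s ^ r * fst (\<tau> ! i), y + int s ^ r * snd (\<tau> ! i))) (g r v)"
        unfolding nbb_fractal.simps Suc[symmetric] by (elim UN_E imageE) auto
      with g_Suc compose show "z \<in> g (Suc r) ` {0..<?k ^ Suc r}"
        by (metis imageI)
    qed
  qed
  have dom: "bij_betw fst ({0..<int (length \<tau> ^ r)} \<times> {0..<int 1}) {0..<?k ^ r}"
    by (rule bij_betw_byWitness[where f' = "\<lambda>w. (w, 0)"]) auto
  have "bij_betw (g r \<circ> fst) ({0..<int (length \<tau> ^ r)} \<times> {0..<int 1}) (nbb_fractal s \<tau> r)"
    using dom inj img by (intro bij_betw_trans[OF dom]) (auto simp: bij_betw_def)
  moreover have "nbb_map s \<tau> r = g r \<circ> fst"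
    by (auto simp: nbb_map_def g_def fun_eq_iff)
  ultimately show ?thesis by simp
qed

section \<open>The program\<close>

text \<open>Registers 5 and 11 hold growing powers of \<open>k\<close> and \<open>s\<close>, 8 is
  the loop counter, 9, 10 and 14 hold constants, 12 and 13 are scratch, and 16 and 17 accumulate the
  coordinates. Register 15 saves twice the thread index, because the first loop consumes register
  0.\<close>

definition power_init :: "nat \<Rightarrow> nat \<Rightarrow> instr list" where
  "power_init s k = [Const 5 (int k), Const 8 1, Const 9 1, Const 10 2, Const 11 (int s),
     Const 14 (-1), Add 15 0 0]"

text \<open>For a bit \<open>e\<close> the factor \<open>1 + e * (K - 1)\<close> is \<open>K ^ e\<close>: it replaces a branch, which
  would break the lockstep.\<close>

definition power_body :: "instr list" where
  "power_body = [Mod 12 0 10, Add 13 5 14, Mul 13 12 13, Add 13 13 9, Div 3 3 13,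
     Div 0 0 10, Mul 5 5 5, Mul 11 11 11, Add 8 8 8]"

definition digit_init :: "nat \<Rightarrow> instr list" where
  "digit_init k = [Const 8 1, Const 18 1, Const 19 (int k)]"

text \<open>Registers 5 and 11 now hold \<open>k ^ p\<close> and \<open>s ^ p\<close>, the stride of
  \<open>p\<close> digits. The counter doubles from 1 up to \<open>p = 2 ^ q\<close>, which gives
  \<open>q\<close> rounds without computing \<open>q\<close>.\<close>

definition digit_body :: "instr list" where
  "digit_body = [Mod 12 3 19, OffsetX 13 12, Mul 13 13 18, Add 16 16 13,
     OffsetY 13 12, Mul 13 13 18, Add 17 17 13, Mul 18 18 11, Div 3 3 5, Add 8 8 8]"

definition reduce_init :: "nat \<Rightarrow> instr list" where
  "reduce_init s = [Const 8 1, Const 11 (int s), Add 20 15 9]"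

text \<open>Thread \<open>t\<close> owns cells \<open>2 * t\<close> and \<open>2 * t + 1\<close>;
  thus thread 0 owns the two result cells.\<close>

definition store_pair :: "instr list" where
  "store_pair = [Store 15 16, Store 20 17]"

text \<open>Thread \<open>t\<close> fetches the pair of thread \<open>t + 2 ^ i\<close> and weights
  it by \<open>s ^ (2 ^ i)\<close>. All loads precede the stores of the round, so only sums of the
  previous round are read.\<close>

definition reduce_body :: "instr list" where
  "reduce_body = [Add 12 8 8, Add 13 15 12, Load 14 13, Mul 14 14 11, Add 16 16 14,
     Add 13 13 9, Load 14 13, Mul 14 14 11, Add 17 17 14]"

definition reduce_tail :: "instr list" where
  "reduce_tail = [Mul 11 11 11, Add 8 8 8]"

definition final_mod :: "instr list" where
  "final_mod = [Mod 16 16 2, Mod 17 17 2]"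

definition nbb_prog :: "nat \<Rightarrow> nat \<Rightarrow> instr list" where
  "nbb_prog s k = power_init s k
     @ power_body @ [JumpLess 8 1 7]
     @ digit_init k
     @ digit_body @ [JumpLess 8 1 20]
     @ reduce_init s @ store_pair
     @ reduce_body @ store_pair @ reduce_tail @ [JumpLess 8 1 36]
     @ final_mod @ store_pair"

lemmas segment_defs = power_init_def power_body_def digit_init_def digit_body_def reduce_init_def
  store_pair_def reduce_body_def reduce_tail_def final_mod_def

text \<open>Evaluating the concatenation confirms that the jump targets 7, 20 and 36 are the starts
  of the three loop bodies.\<close>

lemma nbb_prog_segments:
  "take 7 (drop 0 (nbb_prog s k)) = power_init s k"
  "take 9 (drop 7 (nbb_prog s k)) = power_body"
  "nbb_prog s k ! 16 = JumpLess 8 1 7"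
  "take 3 (drop 17 (nbb_prog s k)) = digit_init k"
  "take 10 (drop 20 (nbb_prog s k)) = digit_body"
  "nbb_prog s k ! 30 = JumpLess 8 1 20"
  "take 3 (drop 31 (nbb_prog s k)) = reduce_init s"
  "take 2 (drop 34 (nbb_prog s k)) = store_pair"
  "take 9 (drop 36 (nbb_prog s k)) = reduce_body"
  "take 2 (drop 45 (nbb_prog s k)) = store_pair"
  "take 2 (drop 47 (nbb_prog s k)) = reduce_tail"
  "nbb_prog s k ! 49 = JumpLess 8 1 36"
  "take 2 (drop 50 (nbb_prog s k)) = final_mod"
  "take 2 (drop 52 (nbb_prog s k)) = store_pair"
  "length (nbb_prog s k) = 54"
  by (simp_all add: nbb_prog_def segment_defs)

text \<open>Even and odd addresses are disjoint, so the second store preserves what the first one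
  wrote.\<close>

lemma lockstep_store_pair:
  assumes seg: "take 2 (drop pc P) = store_pair"
    and addr: "\<And>t. t < p \<Longrightarrow> R t 15 = 2 * int t \<and> R t 20 = 2 * int t + 1"
  shows "\<exists>m'. (block_step P \<tau> ^^ 2) (lockstep p pc R m) (lockstep p (pc + 2) R m') \<and>
    (\<forall>u. m' (2 * int u) = (if u < p then R u 16 else m (2 * int u))) \<and>
    (\<forall>u. m' (2 * int u + 1) = (if u < p then R u 17 else m (2 * int u + 1)))"
proof -
  have "length (take 2 (drop pc P)) = 2" "take 2 (drop pc P) ! 0 = Store 15 16"
    "take 2 (drop pc P) ! 1 = Store 20 17"
    using seg by (simp_all add: store_pair_def)
  then have P: "Suc pc < length P" "P ! pc = Store 15 16" "P ! Suc pc = Store 20 17"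
    by simp_all
  have "\<exists>m1. block_step P \<tau> (lockstep p pc R m) (lockstep p (Suc pc) R m1) \<and>
      (\<forall>t<p. m1 (2 * int t) = R t 16) \<and> (\<forall>x. x \<notin> (\<lambda>t. 2 * int t) ` {..<p} \<longrightarrow> m1 x = m x)"
    by (rule block_step_lockstep_store[OF _ P(2)]) (use P(1) addr in \<open>auto simp: inj_on_def\<close>)
  then obtain m1 where m1: "block_step P \<tau> (lockstep p pc R m) (lockstep p (Suc pc) R m1)"
    "\<forall>t<p. m1 (2 * int t) = R t 16" "\<forall>x. x \<notin> (\<lambda>t. 2 * int t) ` {..<p} \<longrightarrow> m1 x = m x"
    by blast
  have "\<exists>m2. block_step P \<tau> (lockstep p (Suc pc) R m1) (lockstep p (Suc (Suc pc)) R m2) \<and>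
      (\<forall>t<p. m2 (2 * int t + 1) = R t 17) \<and>
      (\<forall>x. x \<notin> (\<lambda>t. 2 * int t + 1) ` {..<p} \<longrightarrow> m2 x = m1 x)"
    by (rule block_step_lockstep_store[OF P(1) P(3)]) (use addr in \<open>auto simp: inj_on_def\<close>)
  then obtain m2 where m2: "block_step P \<tau> (lockstep p (Suc pc) R m1) (lockstep p (Suc (Suc pc)) R m2)"
    "\<forall>t<p. m2 (2 * int t + 1) = R t 17"
    "\<forall>x. x \<notin> (\<lambda>t. 2 * int t + 1) ` {..<p} \<longrightarrow> m2 x = m1 x"
    by blast
  have "(block_step P \<tau> ^^ 2) (lockstep p pc R m) (lockstep p (pc + 2) R m2)"
    using relcomppI[of "block_step P \<tau>", OF m1(1), of "block_step P \<tau>", OF m2(1)] by (simp add: numeral_2_eq_2 eq_OO)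
  moreover have odd: "2 * int t + 1 \<noteq> 2 * int u" for t u
    by presburger
  have "m2 (2 * int u) = (if u < p then R u 16 else m (2 * int u))" for u
  proof -
    have "m2 (2 * int u) = m1 (2 * int u)"
      using m2(3) odd[of _ u] by (simp add: image_iff eq_commute)
    then show ?thesis
      using m1(2,3) by (simp add: image_iff)
  qed
  moreover have "m2 (2 * int u + 1) = (if u < p then R u 17 else m (2 * int u + 1))" for u
  proof (cases "u < p")
    case False
    then have "2 * int u + 1 \<notin> (\<lambda>t. 2 * int t + 1) ` {..<p}" by auto
    moreover have "2 * int u + 1 \<notin> (\<lambda>t. 2 * int t) ` {..<p}"
      using odd[of u] by auto
    ultimately show ?thesis
      using False m1(3) m2(3) by simp
  qed (use m2(2) in simp)
  ultimately show ?thesis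
    by blast
qed

section \<open>Invariants of the three loops\<close>

definition power_inv ::
  "nat \<Rightarrow> (int \<times> int) list \<Rightarrow> nat \<Rightarrow> int \<Rightarrow> int \<Rightarrow> nat \<Rightarrow> (nat \<Rightarrow> nat \<Rightarrow> int) \<Rightarrow> memory \<Rightarrow> bool" where
  "power_inv s \<tau> q nb w i R m \<longleftrightarrow> m = (\<lambda>_. 0) \<and>
     (\<forall>t<2 ^ q. R t 0 = int (t div 2 ^ i) \<and> R t 1 = 2 ^ q \<and> R t 2 = nb \<and>
        R t 3 = w div int (length \<tau>) ^ (t mod 2 ^ i) \<and> R t 5 = int (length \<tau>) ^ (2 ^ i) \<and>
        R t 8 = 2 ^ i \<and> R t 9 = 1 \<and> R t 10 = 2 \<and> R t 11 = int s ^ (2 ^ i) \<and> R t 14 = -1 \<and>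
        R t 15 = 2 * int t \<and> R t 16 = 0 \<and> R t 17 = 0)"

text \<open>Round \<open>i\<close> reads bit \<open>i\<close> of the thread index and, if it is set,
  removes \<open>2 ^ i\<close> digits from register 3. After \<open>q\<close> rounds exactly
  \<open>t\<close> digits are gone, since \<open>t < 2 ^ q\<close>.\<close>

lemma power_inv_step:
  assumes "power_inv s \<tau> q nb w i R m"
  shows "power_inv s \<tau> q nb w (Suc i) (\<lambda>t. fold (reg_exec \<tau> m) power_body (R t)) m"
proof -
  let ?k = "int (length \<tau>)"
  \<comment> \<open>The divisor is \<open>?k ^ 2 ^ i\<close> or 1 according to the bit
    \<open>e\<close>, and successive integer divisions amount to division by the product.\<close>
  have bit: "w div ?k ^ (t mod 2 ^ i) div (int (t div 2 ^ i) mod 2 * (?k ^ 2 ^ i - 1) + 1)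
      = w div ?k ^ (t mod 2 ^ Suc i)" for t
  proof -
    define e where "e = t div 2 ^ i mod 2"
    have "t mod 2 ^ Suc i = t mod 2 ^ i + 2 ^ i * e"
      using mod_mult2_eq[of t "2 ^ i" 2] by (simp add: e_def mult.commute)
    moreover have "int (t div 2 ^ i) mod 2 = int e"
      by (simp add: e_def zmod_int)
    moreover have "e = 0 \<or> e = 1"
      by (auto simp: e_def)
    ultimately show ?thesis
      by (auto simp: power_add zdiv_zmult2_eq)
  qed
  have half: "int (t div 2 ^ i) div 2 = int (t div 2 ^ Suc i)" for t
    by (simp add: zdiv_int[symmetric] div_mult2_eq mult.commute[of 2])
  have square: "x ^ 2 ^ i * x ^ 2 ^ i = x ^ 2 ^ Suc i" for x :: int
    by (simp add: power_add[symmetric] mult_2)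
  have double: "(2 :: int) ^ i + 2 ^ i = 2 ^ Suc i"
    by simp
  show ?thesis
    using assms unfolding power_inv_def
    by (simp add: power_body_def reg_exec_def bit half square double del: power_Suc)
qed

text \<open>The zero memory is carried along because the reduction relies on it for the cells beyond
  the last thread.\<close>

definition digit_inv ::
  "nat \<Rightarrow> (int \<times> int) list \<Rightarrow> nat \<Rightarrow> int \<Rightarrow> int \<Rightarrow> nat \<Rightarrow> (nat \<Rightarrow> nat \<Rightarrow> int) \<Rightarrow> memory \<Rightarrow> bool" where
  "digit_inv s \<tau> q nb w i R m \<longleftrightarrow> m = (\<lambda>_. 0) \<and>
     (\<forall>t<2 ^ q. R t 1 = 2 ^ q \<and> R t 2 = nb \<and>
        R t 3 = w div int (length \<tau>) ^ (t + 2 ^ q * i) \<and> R t 5 = int (length \<tau>) ^ (2 ^ q) \<and>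
        R t 8 = 2 ^ i \<and> R t 9 = 1 \<and> R t 11 = int s ^ (2 ^ q) \<and>
        R t 15 = 2 * int t \<and> R t 18 = int s ^ (2 ^ q * i) \<and> R t 19 = int (length \<tau>) \<and>
        R t 16 = (\<Sum>l<i. int s ^ (2 ^ q * l) * fst (digit \<tau> w (t + 2 ^ q * l))) \<and>
        R t 17 = (\<Sum>l<i. int s ^ (2 ^ q * l) * snd (digit \<tau> w (t + 2 ^ q * l))))"

lemma digit_inv_step:
  assumes "digit_inv s \<tau> q nb w i R m"
  shows "digit_inv s \<tau> q nb w (Suc i) (\<lambda>t. fold (reg_exec \<tau> m) digit_body (R t)) m"
proof -
  let ?k = "int (length \<tau>)"
  have "w div ?k ^ (t + 2 ^ q * i) div ?k ^ 2 ^ q = w div ?k ^ (t + 2 ^ q * Suc i)" for t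
  proof -
    have "?k ^ (t + 2 ^ q * Suc i) = ?k ^ (t + 2 ^ q * i) * ?k ^ 2 ^ q"
      by (simp add: power_add mult.assoc mult.left_commute)
    then show ?thesis by (simp add: zdiv_zmult2_eq)
  qed
  moreover have "int s ^ (2 ^ q * Suc i) = int s ^ (2 ^ q * i) * int s ^ 2 ^ q"
    by (simp add: power_add)
  ultimately show ?thesis
    using assms by (simp add: digit_inv_def digit_body_def reg_exec_def digit_def del: mult_Suc_right)
qed

text \<open>After \<open>i\<close> rounds cell \<open>u\<close> combines the \<open>2 ^ i\<close> partial sums from \<open>u\<close> on. Cells beyond the last
  thread are never written and hold 0, which agrees with the formula since \<open>ax\<close> and \<open>ay\<close> vanish there;
  hence no bound on \<open>u\<close> is needed.\<close>

definition reduce_inv ::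
  "nat \<Rightarrow> nat \<Rightarrow> int \<Rightarrow> (nat \<Rightarrow> int) \<Rightarrow> (nat \<Rightarrow> int) \<Rightarrow> nat \<Rightarrow> (nat \<Rightarrow> nat \<Rightarrow> int) \<Rightarrow> memory \<Rightarrow> bool" where
  "reduce_inv s q nb ax ay i R m \<longleftrightarrow>
     (\<forall>u. m (2 * int u) = (\<Sum>v<2 ^ i. int s ^ v * ax (u + v))) \<and>
     (\<forall>u. m (2 * int u + 1) = (\<Sum>v<2 ^ i. int s ^ v * ay (u + v))) \<and>
     (\<forall>t<2 ^ q. R t 1 = 2 ^ q \<and> R t 2 = nb \<and> R t 8 = 2 ^ i \<and> R t 9 = 1 \<and>
        R t 11 = int s ^ (2 ^ i) \<and> R t 15 = 2 * int t \<and> R t 20 = 2 * int t + 1 \<and>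
        R t 16 = (\<Sum>v<2 ^ i. int s ^ v * ax (t + v)) \<and>
        R t 17 = (\<Sum>v<2 ^ i. int s ^ v * ay (t + v)))"

text \<open>One round of the reduction: the upper half of the window is the window starting at
  \<open>u + 2 ^ i\<close>, with a common factor \<open>s ^ 2 ^ i\<close>.\<close>

lemma weighted_sum_double:
  fixes a :: "nat \<Rightarrow> int"
  shows "(\<Sum>v<2 ^ Suc i. int s ^ v * a (u + v)) = (\<Sum>v<2 ^ i. int s ^ v * a (u + v))
    + (\<Sum>v<2 ^ i. int s ^ v * a (u + 2 ^ i + v)) * int s ^ 2 ^ i"
proof -
  have "(\<Sum>v<2 ^ Suc i. int s ^ v * a (u + v)) =
      (\<Sum>v<2 ^ i. int s ^ v * a (u + v)) + (\<Sum>v=2 ^ i..<2 ^ i + 2 ^ i. int s ^ v * a (u + v))"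
    using sum.atLeastLessThan_concat[of 0 "2 ^ i" "2 ^ i + 2 ^ i" "\<lambda>v. int s ^ v * a (u + v)"]
    by (simp add: atLeast0LessThan mult_2)
  also have "(\<Sum>v=2 ^ i..<2 ^ i + 2 ^ i. int s ^ v * a (u + v)) =
      (\<Sum>v<2 ^ i. int s ^ (v + 2 ^ i) * a (u + (v + 2 ^ i)))"
    using sum.shift_bounds_nat_ivl[of "\<lambda>v. int s ^ v * a (u + v)" 0 "2 ^ i" "2 ^ i"]
    by (simp add: atLeast0LessThan)
  also have "\<dots> = (\<Sum>v<2 ^ i. int s ^ v * a (u + 2 ^ i + v)) * int s ^ 2 ^ i"
    by (simp add: sum_distrib_left power_add ac_simps)
  finally show ?thesis .
qed

lemma reduce_inv_step:
  assumes inv: "reduce_inv s q nb ax ay i R m"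
    and zero: "\<And>u. 2 ^ q \<le> u \<Longrightarrow> ax u = 0 \<and> ay u = 0"
  shows "\<exists>R' m'. (block_step (nbb_prog s k) \<tau> ^^ 13) (lockstep (2 ^ q) 36 R m)
           (lockstep (2 ^ q) 49 R' m') \<and> reduce_inv s q nb ax ay (Suc i) R' m'"
proof -
  define R1 where "R1 = (\<lambda>t. fold (reg_exec \<tau> m) reduce_body (R t))"
  have s1: "(block_step (nbb_prog s k) \<tau> ^^ 9) (lockstep (2 ^ q) 36 R m) (lockstep (2 ^ q) 45 R1 m)"
    unfolding R1_def
    by (rule lockstep_segment[OF nbb_prog_segments(9)]) (simp_all add: reduce_body_def)
  \<comment> \<open>The index \<open>t + 2 ^ i\<close> may exceed the last thread; the memory part
    of the invariant holds there as well.\<close>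
  have load: "m (2 * int t + 2 * 2 ^ i) = (\<Sum>v<2 ^ i. int s ^ v * ax (t + 2 ^ i + v))"
    "m (2 * int t + 2 * 2 ^ i + 1) = (\<Sum>v<2 ^ i. int s ^ v * ay (t + 2 ^ i + v))" for t
  proof -
    have "2 * int t + 2 * 2 ^ i = 2 * int (t + 2 ^ i)"
      by simp
    then show "m (2 * int t + 2 * 2 ^ i) = (\<Sum>v<2 ^ i. int s ^ v * ax (t + 2 ^ i + v))"
      "m (2 * int t + 2 * 2 ^ i + 1) = (\<Sum>v<2 ^ i. int s ^ v * ay (t + 2 ^ i + v))"
      using inv unfolding reduce_inv_def by metis+
  qed
  have R1: "R1 t 1 = 2 ^ q \<and> R1 t 2 = nb \<and> R1 t 8 = 2 ^ i \<and> R1 t 9 = 1 \<and>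
      R1 t 11 = int s ^ (2 ^ i) \<and> R1 t 15 = 2 * int t \<and> R1 t 20 = 2 * int t + 1 \<and>
      R1 t 16 = (\<Sum>v<2 ^ Suc i. int s ^ v * ax (t + v)) \<and>
      R1 t 17 = (\<Sum>v<2 ^ Suc i. int s ^ v * ay (t + v))" if "t < 2 ^ q" for t
    using inv that unfolding weighted_sum_double
    by (simp add: R1_def reduce_body_def reg_exec_def reduce_inv_def load)
  obtain m2 where s2: "(block_step (nbb_prog s k) \<tau> ^^ 2) (lockstep (2 ^ q) 45 R1 m) (lockstep (2 ^ q) 47 R1 m2)"
    and m2: "\<forall>u. m2 (2 * int u) = (if u < 2 ^ q then R1 u 16 else m (2 * int u))"
      "\<forall>u. m2 (2 * int u + 1) = (if u < 2 ^ q then R1 u 17 else m (2 * int u + 1))"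
    using lockstep_store_pair[of 45 "nbb_prog s k" "2 ^ q" R1 \<tau> m] nbb_prog_segments R1 by auto
  define R3 where "R3 = (\<lambda>t. fold (reg_exec \<tau> m2) reduce_tail (R1 t))"
  have s3: "(block_step (nbb_prog s k) \<tau> ^^ 2) (lockstep (2 ^ q) 47 R1 m2) (lockstep (2 ^ q) 49 R3 m2)"
    unfolding R3_def
    by (rule lockstep_segment[OF nbb_prog_segments(11)]) (simp_all add: reduce_tail_def)
  have "(block_step (nbb_prog s k) \<tau> ^^ (9 + 2 + 2)) (lockstep (2 ^ q) 36 R m) (lockstep (2 ^ q) 49 R3 m2)"
    using relpowp_trans[OF relpowp_trans[OF s1 s2] s3] .
  moreover have "reduce_inv s q nb ax ay (Suc i) R3 m2"
  proof -
    have "int s ^ 2 ^ Suc i = int s ^ 2 ^ i * int s ^ 2 ^ i"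
      by (simp add: power_add[symmetric] mult_2)
    \<comment> \<open>For \<open>u \<ge> 2 ^ q\<close> the cell is not written, and the old and the
      new sum are both 0 by \<open>zero\<close>.\<close>
    moreover have "m2 (2 * int u) = (\<Sum>v<2 ^ Suc i. int s ^ v * ax (u + v))"
      "m2 (2 * int u + 1) = (\<Sum>v<2 ^ Suc i. int s ^ v * ay (u + v))" for u
      using m2 R1[of u] inv zero by (auto simp: reduce_inv_def)
    ultimately show ?thesis
      using R1 unfolding reduce_inv_def by (simp add: R3_def reduce_tail_def reg_exec_def)
  qed
  ultimately show ?thesis by auto
qed

section \<open>Correctness and running time of the program\<close>

lemma strided_digit_sum:
  fixes a :: "nat \<Rightarrow> int"
  shows "(\<Sum>v<p. int s ^ v * (\<Sum>l<q. int s ^ (p * l) * a (v + p * l))) = (\<Sum>j<q * p. int s ^ j * a j)"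
proof -
  have "(\<Sum>v<p. int s ^ v * (\<Sum>l<q. int s ^ (p * l) * a (v + p * l)))
      = (\<Sum>v<p. \<Sum>l<q. int s ^ (v + l * p) * a (v + l * p))"
    by (simp add: sum_distrib_left power_add mult.assoc mult.commute[of p])
  \<comment> \<open>After the swap the inner sum runs over \<open>p\<close> consecutive positions
    from \<open>l * p\<close> on, and these blocks tile the range below
    \<open>q * p\<close>.\<close>
  also have "\<dots> = (\<Sum>l<q. \<Sum>v<p. int s ^ (v + l * p) * a (v + l * p))"
    by (rule sum.swap)
  also have "\<dots> = (\<Sum>l<q. \<Sum>j=l * p..<l * p + p. int s ^ j * a j)"
    using sum.shift_bounds_nat_ivl[of "\<lambda>j. int s ^ j * a j" 0 "l * p" p for l]
    by (simp add: atLeast0LessThan add.commute[of p])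
  also have "\<dots> = (\<Sum>j<q * p. int s ^ j * a j)"
    by (rule sum.nat_group)
  finally show ?thesis .
qed

text \<open>The time bound is exact counting: 19 instructions lie outside the loops, and a round of
  the three loops costs 10, 11 and 14 steps.\<close>

lemma nbb_prog_correct:
  assumes "s \<ge> 1" and "set \<tau> \<subseteq> {0..<int s} \<times> {0..<int s}" and "q \<ge> 1" and "r \<le> q * 2 ^ q"
  shows "block_computes_within (nbb_prog s (length \<tau>)) \<tau> (2 ^ q) (s ^ r) \<omega> (nbb_map s \<tau> r \<omega>) (19 + 35 * q)"
proof -
  let ?P = "nbb_prog s (length \<tau>)" and ?p = "2 ^ q :: nat" and ?w = "fst \<omega>" and ?nb = "int (s ^ r)"
  note seg = nbb_prog_segments[of s "length \<tau>"]
  define R0 where "R0 t = snd (init_thread ?p (s ^ r) \<omega> t)" for t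
  have init: "init_block ?p (s ^ r) \<omega> = lockstep ?p 0 R0 (\<lambda>_. 0)"
    by (simp add: init_block_def lockstep_def R0_def init_thread_def)

  define R1 where "R1 t = fold (reg_exec \<tau> (\<lambda>_. 0)) (power_init s (length \<tau>)) (R0 t)" for t
  have s1: "(block_step ?P \<tau> ^^ 7) (lockstep ?p 0 R0 (\<lambda>_. 0)) (lockstep ?p 7 R1 (\<lambda>_. 0))"
    unfolding R1_def by (rule lockstep_segment[OF seg(1)]) (simp_all add: power_init_def)
  have i1: "power_inv s \<tau> q ?nb ?w 0 R1 (\<lambda>_. 0)"
    by (simp add: power_inv_def R1_def R0_def init_thread_def power_init_def reg_exec_def)

  have "\<exists>R' m'. (block_step ?P \<tau> ^^ (q * Suc 9)) (lockstep ?p 7 R1 (\<lambda>_. 0))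
      (lockstep ?p (7 + Suc 9) R' m') \<and> power_inv s \<tau> q ?nb ?w q R' m'"
  proof (rule lockstep_loop[where I = "power_inv s \<tau> q ?nb ?w"])
    fix i R m assume inv: "power_inv s \<tau> q ?nb ?w i R m"
    have "(block_step ?P \<tau> ^^ 9) (lockstep ?p 7 R m)
        (lockstep ?p (7 + 9) (\<lambda>t. fold (reg_exec \<tau> m) power_body (R t)) m)"
      by (rule lockstep_segment[OF seg(2)]) (simp_all add: power_body_def)
    with power_inv_step[OF inv] show "\<exists>R' m'. (block_step ?P \<tau> ^^ 9) (lockstep ?p 7 R m)
        (lockstep ?p (7 + 9) R' m') \<and> power_inv s \<tau> q ?nb ?w (Suc i) R' m'"
      by blast
  next
    fix i R m t assume "power_inv s \<tau> q ?nb ?w i R m" "t < ?p"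
    then show "R t 8 < R t 1 \<longleftrightarrow> i < q" by (simp add: power_inv_def)
  qed (use assms(3) i1 seg in simp_all)
  then obtain R2 m2 where s2: "(block_step ?P \<tau> ^^ (q * Suc 9)) (lockstep ?p 7 R1 (\<lambda>_. 0)) (lockstep ?p 17 R2 m2)"
    and i2: "power_inv s \<tau> q ?nb ?w q R2 m2"
    by auto

  define R3 where "R3 t = fold (reg_exec \<tau> m2) (digit_init (length \<tau>)) (R2 t)" for t
  have s3: "(block_step ?P \<tau> ^^ 3) (lockstep ?p 17 R2 m2) (lockstep ?p 20 R3 m2)"
    unfolding R3_def by (rule lockstep_segment[OF seg(4)]) (simp_all add: digit_init_def)
  have i3: "digit_inv s \<tau> q ?nb ?w 0 R3 m2"
    using i2 by (simp add: power_inv_def digit_inv_def R3_def digit_init_def reg_exec_def)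

  have "\<exists>R' m'. (block_step ?P \<tau> ^^ (q * Suc 10)) (lockstep ?p 20 R3 m2)
      (lockstep ?p (20 + Suc 10) R' m') \<and> digit_inv s \<tau> q ?nb ?w q R' m'"
  proof (rule lockstep_loop[where I = "digit_inv s \<tau> q ?nb ?w"])
    fix i R m assume inv: "digit_inv s \<tau> q ?nb ?w i R m"
    have "(block_step ?P \<tau> ^^ 10) (lockstep ?p 20 R m)
        (lockstep ?p (20 + 10) (\<lambda>t. fold (reg_exec \<tau> m) digit_body (R t)) m)"
      by (rule lockstep_segment[OF seg(5)]) (simp_all add: digit_body_def)
    with digit_inv_step[OF inv] show "\<exists>R' m'. (block_step ?P \<tau> ^^ 10) (lockstep ?p 20 R m)
        (lockstep ?p (20 + 10) R' m') \<and> digit_inv s \<tau> q ?nb ?w (Suc i) R' m'"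
      by blast
  next
    fix i R m t assume "digit_inv s \<tau> q ?nb ?w i R m" "t < ?p"
    then show "R t 8 < R t 1 \<longleftrightarrow> i < q" by (simp add: digit_inv_def)
  qed (use assms(3) i3 seg in simp_all)
  then obtain R4 m4 where s4: "(block_step ?P \<tau> ^^ (q * Suc 10)) (lockstep ?p 20 R3 m2) (lockstep ?p 31 R4 m4)"
    and i4: "digit_inv s \<tau> q ?nb ?w q R4 m4"
    by auto

  \<comment> \<open>Partial sums are cut off to 0 beyond the last thread, in agreement with the
    untouched memory.\<close>
  define part :: "(int \<times> int \<Rightarrow> int) \<Rightarrow> nat \<Rightarrow> int" where
    "part f t = (if t < ?p then \<Sum>l<q. int s ^ (2 ^ q * l) * f (digit \<tau> ?w (t + 2 ^ q * l)) else 0)" for f t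
  define R5 where "R5 t = fold (reg_exec \<tau> m4) (reduce_init s) (R4 t)" for t
  have s5: "(block_step ?P \<tau> ^^ 3) (lockstep ?p 31 R4 m4) (lockstep ?p 34 R5 m4)"
    unfolding R5_def by (rule lockstep_segment[OF seg(7)]) (simp_all add: reduce_init_def)
  have R5: "R5 t 1 = 2 ^ q \<and> R5 t 2 = ?nb \<and> R5 t 8 = 1 \<and> R5 t 9 = 1 \<and> R5 t 11 = int s \<and>
      R5 t 15 = 2 * int t \<and> R5 t 20 = 2 * int t + 1 \<and> R5 t 16 = part fst t \<and> R5 t 17 = part snd t"
    if "t < ?p" for t
    using i4 that by (simp add: digit_inv_def R5_def reduce_init_def reg_exec_def part_def)
  have m4: "m4 = (\<lambda>_. 0)"
    using i4 by (simp add: digit_inv_def)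
  have "\<exists>m'. (block_step ?P \<tau> ^^ 2) (lockstep ?p 34 R5 m4) (lockstep ?p (34 + 2) R5 m') \<and>
      (\<forall>u. m' (2 * int u) = (if u < ?p then R5 u 16 else m4 (2 * int u))) \<and>
      (\<forall>u. m' (2 * int u + 1) = (if u < ?p then R5 u 17 else m4 (2 * int u + 1)))"
    using R5 by (intro lockstep_store_pair[OF seg(8)]) simp
  then obtain m6 where s6: "(block_step ?P \<tau> ^^ 2) (lockstep ?p 34 R5 m4) (lockstep ?p 36 R5 m6)"
    and m6: "\<forall>u. m6 (2 * int u) = (if u < ?p then R5 u 16 else m4 (2 * int u))"
      "\<forall>u. m6 (2 * int u + 1) = (if u < ?p then R5 u 17 else m4 (2 * int u + 1))"
    by auto
  have m6': "m6 (2 * int u) = part fst u" "m6 (2 * int u + 1) = part snd u" for u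
    using m6 m4 R5[of u] by (auto simp: part_def)
  have i6: "reduce_inv s q ?nb (part fst) (part snd) 0 R5 m6"
    using R5 m6' by (simp add: reduce_inv_def)

  have "\<exists>R' m'. (block_step ?P \<tau> ^^ (q * Suc 13)) (lockstep ?p 36 R5 m6)
      (lockstep ?p (36 + Suc 13) R' m') \<and> reduce_inv s q ?nb (part fst) (part snd) q R' m'"
  proof (rule lockstep_loop[where I = "reduce_inv s q ?nb (part fst) (part snd)"])
    fix i R m assume "reduce_inv s q ?nb (part fst) (part snd) i R m"
    from reduce_inv_step[OF this, where k = "length \<tau>" and \<tau> = \<tau>]
    show "\<exists>R' m'. (block_step ?P \<tau> ^^ 13) (lockstep ?p 36 R m)
        (lockstep ?p (36 + 13) R' m') \<and> reduce_inv s q ?nb (part fst) (part snd) (Suc i) R' m'"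
      by (simp add: part_def)
  next
    fix i R m t assume "reduce_inv s q ?nb (part fst) (part snd) i R m" "t < ?p"
    then show "R t 8 < R t 1 \<longleftrightarrow> i < q" by (simp add: reduce_inv_def)
  qed (use assms(3) i6 seg in simp_all)
  then obtain R7 m7 where s7: "(block_step ?P \<tau> ^^ (q * Suc 13)) (lockstep ?p 36 R5 m6) (lockstep ?p 50 R7 m7)"
    and i7: "reduce_inv s q ?nb (part fst) (part snd) q R7 m7"
    by auto

  define R8 where "R8 t = fold (reg_exec \<tau> m7) final_mod (R7 t)" for t
  have s8: "(block_step ?P \<tau> ^^ 2) (lockstep ?p 50 R7 m7) (lockstep ?p 52 R8 m7)"
    unfolding R8_def by (rule lockstep_segment[OF seg(13)]) (simp_all add: final_mod_def)
  have R8: "R8 t 15 = 2 * int t \<and> R8 t 20 = 2 * int t + 1 \<and>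
      R8 t 16 = (\<Sum>v<2 ^ q. int s ^ v * part fst (t + v)) mod ?nb \<and>
      R8 t 17 = (\<Sum>v<2 ^ q. int s ^ v * part snd (t + v)) mod ?nb" if "t < ?p" for t
    using i7 that by (simp add: reduce_inv_def R8_def final_mod_def reg_exec_def)
  have "\<exists>m'. (block_step ?P \<tau> ^^ 2) (lockstep ?p 52 R8 m7) (lockstep ?p (52 + 2) R8 m') \<and>
      (\<forall>u. m' (2 * int u) = (if u < ?p then R8 u 16 else m7 (2 * int u))) \<and>
      (\<forall>u. m' (2 * int u + 1) = (if u < ?p then R8 u 17 else m7 (2 * int u + 1)))"
    using R8 by (intro lockstep_store_pair[OF seg(14)]) simp
  then obtain m9 where s9: "(block_step ?P \<tau> ^^ 2) (lockstep ?p 52 R8 m7) (lockstep ?p 54 R8 m9)"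
    and m9: "\<forall>u. m9 (2 * int u) = (if u < ?p then R8 u 16 else m7 (2 * int u))"
      "\<forall>u. m9 (2 * int u + 1) = (if u < ?p then R8 u 17 else m7 (2 * int u + 1))"
    by auto

  \<comment> \<open>The threads together sum \<open>q * 2 ^ q \<ge> r\<close> digits; the surplus
    disappears modulo \<open>s ^ r\<close>.\<close>
  have total: "(\<Sum>v<2 ^ q. int s ^ v * part f v) mod ?nb = coord s \<tau> f ?w r"
    if f: "f = fst \<or> f = snd" for f
  proof -
    have "(\<Sum>v<2 ^ q. int s ^ v * part f v) = (\<Sum>j<q * 2 ^ q. int s ^ j * f (digit \<tau> ?w j))"
      using strided_digit_sum[where p = "2 ^ q" and a = "\<lambda>j. f (digit \<tau> ?w j)"] by (simp add: part_def)
    then show ?thesis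
      using digit_sum_mod[of "\<lambda>j. f (digit \<tau> ?w j)" s r "q * 2 ^ q"]
        lookup_bounds[OF assms(1,2) f] assms(4)
      by (simp add: coord_def digit_def)
  qed
  have "m9 0 = coord s \<tau> fst ?w r" "m9 1 = coord s \<tau> snd ?w r"
    using m9[THEN spec, of 0] R8[of 0] total[of fst] total[of snd] by simp_all
  then have "(m9 0, m9 1) = nbb_map s \<tau> r \<omega>"
    by (simp add: nbb_map_def)
  moreover have "(block_step ?P \<tau> ^^ (7 + q * Suc 9 + 3 + q * Suc 10 + 3 + 2 + q * Suc 13 + 2 + 2))
      (init_block ?p (s ^ r) \<omega>) (lockstep ?p 54 R8 m9)"
    unfolding init
    by (intro relpowp_trans[OF _ s9] relpowp_trans[OF _ s8] relpowp_trans[OF _ s7] relpowp_trans[OF _ s6]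
        relpowp_trans[OF _ s5] relpowp_trans[OF _ s4] relpowp_trans[OF _ s3] relpowp_trans[OF _ s2] s1)
  moreover have "7 + q * Suc 9 + 3 + q * Suc 10 + 3 + 2 + q * Suc 13 + 2 + 2 \<le> 19 + 35 * q"
    by simp
  moreover have "\<forall>th\<in>set (map (\<lambda>t. (54, R8 t)) [0..<?p]). halted ?P th"
    using seg(15) by (simp add: halted_def)
  ultimately show ?thesis
    unfolding block_computes_within_def lockstep_def by blast
qed

section \<open>The number of threads\<close>

text \<open>\<open>q * 2 ^ q\<close> is the number of digits that \<open>2 ^ q\<close> threads
  handle in \<open>q\<close> rounds. Taking the least \<open>q\<close> makes \<open>2 ^ q\<close> of
  order \<open>r / log r\<close>.\<close>

definition thread_exp :: "nat \<Rightarrow> nat" where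
  "thread_exp r = (LEAST q. 1 \<le> q \<and> r \<le> q * 2 ^ q)"

lemma thread_exp: "1 \<le> thread_exp r" "r \<le> thread_exp r * 2 ^ thread_exp r"
proof -
  have "r * 1 \<le> Suc r * 2 ^ Suc r"
    by (intro mult_le_mono one_le_power) simp_all
  then have "1 \<le> Suc r \<and> r \<le> Suc r * 2 ^ Suc r"
    by simp
  then have "1 \<le> thread_exp r \<and> r \<le> thread_exp r * 2 ^ thread_exp r"
    unfolding thread_exp_def by (rule LeastI)
  then show "1 \<le> thread_exp r" "r \<le> thread_exp r * 2 ^ thread_exp r"
    by auto
qed

text \<open>With \<open>c = log 2 s\<close> the product \<open>r * c\<close> is the logarithm of the
  linear size and \<open>Y\<close> its iterated logarithm. The bounds come from
  \<open>r \<le> q * 2 ^ q\<close> and from the failure of this inequality at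
  \<open>q - 1\<close>.\<close>

lemma thread_exp_bounds:
  fixes c :: real
  assumes "r \<ge> 3" and "c \<ge> 1"
  defines "q \<equiv> real (thread_exp r)" and "Y \<equiv> log 2 (real r * c)"
  shows "0 < Y" and "q \<le> 2 * Y" and "Y \<le> (2 + log 2 c) * q" and "q * 2 ^ thread_exp r \<le> 4 * (real r * c)"
proof -
  \<comment> \<open>Since \<open>1 * 2 ^ 1 < 3\<close>, the exponent 1 is too small; hence the
    predecessor \<open>e\<close> is at least 1 and minimality applies to it.\<close>
  have "thread_exp r \<noteq> 1"
    using thread_exp(2)[of r] assms(1) by auto
  then have "thread_exp r \<ge> 2"
    using thread_exp(1)[of r] by simp
  then obtain e where e: "thread_exp r = Suc e" "e \<ge> 1"
    by (cases "thread_exp r") auto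
  have "\<not> (1 \<le> e \<and> r \<le> e * 2 ^ e)"
    using e(1) unfolding thread_exp_def by (intro not_less_Least) simp
  then have small: "e * 2 ^ e < r"
    using e(2) by simp
  have "1 * 2 ^ e \<le> e * 2 ^ e"
    using e(2) by (intro mult_le_mono1)
  with small have "2 ^ e \<le> r"
    by linarith
  then have "real (2 ^ e) \<le> real r"
    by (simp only: of_nat_le_iff)
  then have "real e \<le> log 2 (real r)"
    using assms(1) by (simp add: le_log_iff powr_realpow)
  moreover have logs: "Y = log 2 (real r) + log 2 c" "0 \<le> log 2 c"
    using assms(1,2) by (simp_all add: Y_def log_mult)
  moreover have "q = real e + 1" "real e \<ge> 1"
    using e by (simp_all add: q_def)
  \<comment> \<open>Here \<open>q = e + 1 \<le> 2 * e\<close>, and \<open>e\<close> is at most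
    \<open>log 2 r\<close>, hence at most \<open>Y\<close>.\<close>
  ultimately show "0 < Y" "q \<le> 2 * Y"
    by auto
  have "real r \<le> real (thread_exp r * 2 ^ thread_exp r)"
    using thread_exp(2)[of r] by (simp only: of_nat_le_iff)
  then have "log 2 (real r) \<le> log 2 (q * 2 ^ thread_exp r)"
    using assms(1) by (simp add: q_def)
  also have "\<dots> = log 2 q + q"
    using e by (simp add: q_def log_mult log_nat_power)
  also have "log 2 q \<le> q"
  proof -
    have "thread_exp r \<le> 2 ^ thread_exp r"
      by (rule less_imp_le[OF less_exp])
    then have "real (thread_exp r) \<le> real (2 ^ thread_exp r)"
      by (simp only: of_nat_le_iff)
    then have "real (thread_exp r) \<le> 2 powr real (thread_exp r)"
      by (simp add: powr_realpow)
    then show ?thesis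
      using thread_exp(1)[of r] by (simp add: q_def log_le_iff)
  qed
  finally have "log 2 (real r) \<le> 2 * q"
    by simp
  moreover have "log 2 c * 1 \<le> log 2 c * q"
    using logs(2) e by (intro mult_left_mono) (auto simp: q_def)
  ultimately show "Y \<le> (2 + log 2 c) * q"
    using logs by (simp add: algebra_simps)
  \<comment> \<open>The factor 4 combines \<open>e + 1 \<le> 2 * e\<close> with
    \<open>2 ^ (e + 1) = 2 * 2 ^ e\<close>.\<close>
  have "thread_exp r * 2 ^ thread_exp r \<le> 4 * (e * 2 ^ e)"
    using e by (simp add: algebra_simps)
  then have "thread_exp r * 2 ^ thread_exp r \<le> 4 * r"
    using small by linarith
  then have "real (thread_exp r * 2 ^ thread_exp r) \<le> real (4 * r)"
    by (simp only: of_nat_le_iff)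
  moreover have "real r * 1 \<le> real r * c"
    using assms(2) by (intro mult_left_mono) auto
  ultimately show "q * 2 ^ thread_exp r \<le> 4 * (real r * c)"
    by (simp add: q_def)
qed

text \<open>\<open>q\<close> and \<open>Y\<close> agree up to constants and \<open>q * 2 ^ q\<close>
  lies between \<open>r\<close> and \<open>4 * r * c\<close>; dividing by \<open>Y\<close> gives
  both directions.\<close>

lemma thread_count_bigtheta:
  fixes c :: real
  assumes "c \<ge> 1"
  shows "(\<lambda>r. real (2 ^ thread_exp r)) \<in> \<Theta>(\<lambda>r. (real r * c) / log 2 (real r * c))"
proof (rule bigthetaI)
  let ?D = "2 + log 2 c"
  show "(\<lambda>r. real (2 ^ thread_exp r)) \<in> O(\<lambda>r. (real r * c) / log 2 (real r * c))"
  proof (rule bigoI, rule eventually_sequentiallyI)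
    fix r :: nat assume r: "3 \<le> r"
    let ?q = "real (thread_exp r)" and ?Y = "log 2 (real r * c)"
    note b = thread_exp_bounds[OF r assms]
    have D: "?D > 0"
      using assms by (simp add: add_pos_nonneg)
    have "2 ^ thread_exp r * ?Y \<le> 2 ^ thread_exp r * (?D * ?q)"
      using b(3) by (intro mult_left_mono) auto
    also have "\<dots> = ?D * (?q * 2 ^ thread_exp r)"
      by simp
    also have "\<dots> \<le> ?D * (4 * (real r * c))"
      using b(4) D by (intro mult_left_mono) auto
    finally have "2 ^ thread_exp r \<le> 4 * ?D * ((real r * c) / ?Y)"
      using b(1) by (simp add: field_simps)
    then show "norm (real (2 ^ thread_exp r)) \<le> 4 * ?D * norm ((real r * c) / ?Y)"
      using b(1) assms by simp
  qed
  show "(\<lambda>r. real (2 ^ thread_exp r)) \<in> \<Omega>(\<lambda>r. (real r * c) / log 2 (real r * c))"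
    unfolding bigomega_iff_bigo
  proof (rule bigoI, rule eventually_sequentiallyI)
    fix r :: nat assume r: "3 \<le> r"
    let ?q = "real (thread_exp r)" and ?Y = "log 2 (real r * c)"
    note b = thread_exp_bounds[OF r assms]
    have "real r \<le> real (thread_exp r * 2 ^ thread_exp r)"
      using thread_exp(2)[of r] by (simp only: of_nat_le_iff)
    then have "real r * c \<le> ?q * 2 ^ thread_exp r * c"
      using assms by (intro mult_right_mono) auto
    also have "\<dots> \<le> 2 * ?Y * 2 ^ thread_exp r * c"
      using b(2) assms by (intro mult_right_mono) auto
    finally have "(real r * c) / ?Y \<le> 2 * c * 2 ^ thread_exp r"
      using b(1) by (simp add: divide_le_eq mult_ac)
    then show "norm ((real r * c) / ?Y) \<le> 2 * c * norm (real (2 ^ thread_exp r))"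
      using b(1) assms by simp
  qed
qed

lemma thread_time_bigo:
  fixes c :: real
  assumes "c \<ge> 1"
  shows "(\<lambda>r. real (19 + 35 * thread_exp r)) \<in> O(\<lambda>r. log 2 (real r * c))"
proof (rule bigoI, rule eventually_sequentiallyI)
  fix r :: nat assume r: "3 \<le> r"
  \<comment> \<open>As \<open>q \<ge> 1\<close>, the time is at most \<open>54 * q\<close>, and
    \<open>q\<close> is at most twice the iterated logarithm.\<close>
  show "norm (real (19 + 35 * thread_exp r)) \<le> 108 * norm (log 2 (real r * c))"
    using thread_exp_bounds(1,2)[OF r assms] thread_exp(1)[of r] by simp
qed

text \<open>The dimension is chosen so that \<open>s powr nbb_dim s k = k\<close>. It is
  nonnegative, so the factor \<open>b \<ge> 1\<close> only enlarges the right side, and the constant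
  1 suffices.\<close>

lemma card_parallel_space_le:
  assumes "s \<ge> 2" and "k \<ge> 1" and "b \<ge> 1"
  shows "real (k ^ r) \<le> real (b * s ^ r) powr nbb_dim s k"
proof -
  have dim: "0 \<le> nbb_dim s k"
    using assms by (simp add: nbb_dim_def)
  have "real s powr nbb_dim s k = real k"
    using assms by (simp add: powr_def nbb_dim_def)
  then have "real (k ^ r) = (real s powr nbb_dim s k) ^ r"
    by simp
  also have "\<dots> = real (s ^ r) powr nbb_dim s k"
    using assms(1) by (simp add: powr_realpow[symmetric] powr_powr mult.commute)
  also have "\<dots> \<le> real (b * s ^ r) powr nbb_dim s k"
    using assms(3) dim by (intro powr_mono2 of_nat_mono) auto
  finally show ?thesis .
qed

text \<open>The program is chosen before \<open>r\<close> and \<open>b\<close>, so a single program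
  serves all sizes. The guard \<open>B r \<le> b\<^sup>2\<close> ensures that a block of
  \<open>b\<close> by \<open>b\<close> threads can supply the \<open>B r\<close> threads.\<close>

theorem theorem1:
  fixes s k :: nat and \<tau> :: "(int \<times> int) list"
  assumes "s \<ge> 2" and "k \<ge> 1"
    and "length \<tau> = k" and "distinct \<tau>"
    and "set \<tau> \<subseteq> {0..<int s} \<times> {0..<int s}"
  shows "\<exists>(P :: instr list) (B :: nat \<Rightarrow> nat) (T :: nat \<Rightarrow> nat) (C :: real).
      (\<lambda>r. real (B r)) \<in> \<Theta>(\<lambda>r. log 2 (real (s ^ r)) / log 2 (log 2 (real (s ^ r)))) \<and>
      (\<lambda>r. real (T r)) \<in> O(\<lambda>r. log 2 (log 2 (real (s ^ r)))) \<and>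
      (\<forall>r b :: nat. b \<ge> 1 \<longrightarrow>
         (\<exists>(Pi2 :: (int \<times> int) set) (lam :: int \<times> int \<Rightarrow> int \<times> int).
            is_orthotope2 Pi2 \<and>
            real (card Pi2) \<le> C * real (b * s ^ r) powr nbb_dim s k \<and>
            bij_betw lam Pi2 (nbb_fractal s \<tau> r) \<and>
            (B r \<le> b\<^sup>2 \<longrightarrow>
               (\<forall>\<omega>\<in>Pi2. block_computes_within P \<tau> (B r) (s ^ r) \<omega> (lam \<omega>) (T r)))))"
proof -
  let ?c = "log 2 (real s)"
  have c: "?c \<ge> 1"
    using assms(1) by simp
  have log_size: "log 2 (real (s ^ r)) = real r * ?c" for r
    using assms(1) by (simp add: log_nat_power)
  have "s \<ge> 1" "\<tau> \<noteq> []"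
    using assms by auto
  have space: "\<exists>Pi2 lam. is_orthotope2 Pi2 \<and>
      real (card Pi2) \<le> 1 * real (b * s ^ r) powr nbb_dim s k \<and>
      bij_betw lam Pi2 (nbb_fractal s \<tau> r) \<and>
      (2 ^ thread_exp r \<le> b\<^sup>2 \<longrightarrow> (\<forall>\<omega>\<in>Pi2. block_computes_within (nbb_prog s k) \<tau>
         (2 ^ thread_exp r) (s ^ r) \<omega> (lam \<omega>) (19 + 35 * thread_exp r)))"
    if "b \<ge> 1" for r b :: nat
  proof (intro exI conjI impI ballI)
    let ?Pi = "{0..<int (length \<tau> ^ r)} \<times> {0..<int 1}"
    show "is_orthotope2 ?Pi"
      unfolding is_orthotope2_def by blast
    show "real (card ?Pi) \<le> 1 * real (b * s ^ r) powr nbb_dim s k"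
      using card_parallel_space_le[OF assms(1,2) that] assms(3) by simp
    show "bij_betw (nbb_map s \<tau> r) ?Pi (nbb_fractal s \<tau> r)"
      by (rule bij_betw_nbb_map[OF \<open>s \<ge> 1\<close> \<open>\<tau> \<noteq> []\<close> assms(4,5)])
    show "block_computes_within (nbb_prog s k) \<tau> (2 ^ thread_exp r) (s ^ r) \<omega> (nbb_map s \<tau> r \<omega>)
        (19 + 35 * thread_exp r)" for \<omega>
      using nbb_prog_correct[OF \<open>s \<ge> 1\<close> assms(5) thread_exp] assms(3) by simp
  qed
  show ?thesis
    unfolding log_size
    by (intro exI[of _ "nbb_prog s k"] exI[of _ "\<lambda>r. 2 ^ thread_exp r"]
        exI[of _ "\<lambda>r. 19 + 35 * thread_exp r"] exI[of _ "1 :: real"] conjI allI impI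
        thread_count_bigtheta[OF c] thread_time_bigo[OF c] space)
qed

end
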